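(* Let $M\ge 4N-2$. Then a generic $N$-dimensional complex subspace $W\subset\mathbb C^M$ has the property: if $v=(v_1,\dots,v_M)$ and $w=(w_1,\dots,w_M)$ are vectors in $W$ with $|v_i|=|w_i|$ for all $i$, then $v=\lambda w$ for some $\lambda\in\mathbb C$ with $|\lambda|=1$.
   Context: "Generic" means: for all $W$ in an open dense subset of the complex Grassmannian $Gr(N,M)^{\mathbb C}$ of $N$-dimensional complex subspaces of $\mathbb C^M$. *)

theory Defs
  imports "HOL-Analysis.Analysis"
begin

text \<open>Frames: complex M x N matrices (M = CARD('m), N = CARD('n)) of full column rank,
  i.e. injective linear maps C^N -> C^M.\<close>
definition frames :: "(complex^'n::finite^'m::finite) set" where
  "frames = {A. inj ((*v) A)}"

text \<open>The complex Grassmannian Gr(N,M): N-dimensional complex subspaces of C^M,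
  realised as column spaces of frames.\<close>
definition grassmannian :: "('n::finite) itself \<Rightarrow> (complex^'m) set set" where
  "grassmannian t = {range ((*v) (A::complex^'n^'m)) | A. A \<in> frames}"

text \<open>Its standard topology: the quotient topology induced by the surjection
  frames -> Gr(N,M), A |-> column space of A.\<close>
definition gr_top :: "('n::finite) itself \<Rightarrow> (complex^'m::finite) set topology" where
  "gr_top t = topology (\<lambda>U. U \<subseteq> grassmannian t \<and>
      openin (top_of_set (frames :: (complex^'n^'m) set))
             {A \<in> frames. range ((*v) A) \<in> U})"

end

theory Submission
  imports Defs
begin

text \<open>If \<open>|v\<^sub>i| = |w\<^sub>i|\<close> for all \<open>i\<close>, then \<open>a = v + w\<close> and \<open>b = v - w\<close> are entrywise orthogonal as
  vectors of \<open>\<real>\<^sup>2\<close>, and the trivial such pairs, \<open>a = 0\<close> or \<open>b \<in> \<i>\<real> a\<close>, are exactly those with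
  \<open>v = c w\<close>, \<open>|c| = 1\<close>. Call a matrix \<open>A\<close> degenerate if \<open>A x\<close>, \<open>A y\<close> are entrywise orthogonal
  for unit vectors \<open>x\<close>, \<open>y\<close> with \<open>y\<close> real-orthogonal to \<open>\<i> x\<close>; the non-degenerate matrices are
  precisely the frames whose column space admits only trivial pairs. By compactness of the
  spheres the degenerate matrices form a closed set. They also form a null set: normalising
  \<open>x\<^sub>j = 1\<close> and \<open>y = z + \<rho> x\<close> with \<open>z\<^sub>j = 0 \<noteq> z\<^sub>k\<close>, a degenerate \<open>A\<close> is a smooth function of
  its columns other than \<open>j\<close>, \<open>k\<close>, of the moduli and common arguments of the entries of \<open>A x\<close>
  and \<open>A y\<close>, and of the \<open>4N - 3\<close> real coordinates of \<open>x\<close>, \<open>z\<close>, \<open>\<rho>\<close>; when \<open>M - 1 \<ge> 4N - 3\<close>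
  all of this fits into a real hyperplane of the space of \<open>M \<times> N\<close> matrices. Hence the subspaces
  spanned by non-degenerate frames form an open dense subset of the Grassmannian.\<close>

definition entrywise_orthogonal :: "complex^'m \<Rightarrow> complex^'m \<Rightarrow> bool" where
  "entrywise_orthogonal a b \<longleftrightarrow> (\<forall>i. Re (cnj (a $ i) * b $ i) = 0)"

definition orthogonally_rigid :: "(complex^'m) set \<Rightarrow> bool" where
  "orthogonally_rigid W \<longleftrightarrow> (\<forall>a\<in>W. \<forall>b\<in>W.
     entrywise_orthogonal a b \<longrightarrow> a = 0 \<or> (\<exists>t::real. b = (\<i> * of_real t) *s a))"

definition degenerate :: "complex^'n^'m \<Rightarrow> bool" where
  "degenerate A \<longleftrightarrow> (\<exists>x y. norm x = 1 \<and> norm y = 1 \<and> inner (\<i> *s x) y = 0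
     \<and> entrywise_orthogonal (A *v x) (A *v y))"

lemma matrix_vector_scaleR_commute:
  fixes A :: "'a::real_algebra_1^'n^'m"
  shows "A *v (c *\<^sub>R x) = c *\<^sub>R (A *v x)"
  by (simp add: vec_eq_iff matrix_vector_mult_def scaleR_sum_right)

lemma vector_smult_scaleR_commute:
  fixes x :: "'a::real_algebra_1^'n"
  shows "c *s (r *\<^sub>R x) = r *\<^sub>R (c *s x)"
  by (simp add: vec_eq_iff)

lemma i_real_smult: "(\<i> * of_real t) *s (x::complex^'n) = t *\<^sub>R (\<i> *s x)"
  by (simp add: vec_eq_iff) (simp add: scaleR_conv_of_real)

lemma inner_i_scaled_self: "inner (\<i> *s x) (x::complex^'n) = 0"
  by (simp add: inner_vec_def inner_complex_def)

lemma norm_i_scaled [simp]: "norm (\<i> *s x) = norm (x::complex^'n)"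
  by (simp add: norm_vec_def norm_mult)

lemma entrywise_orthogonal_shear:
  assumes "entrywise_orthogonal a b"
  shows "entrywise_orthogonal (c *s a) (c *s b + (\<i> * of_real t) *s (c *s a))"
  unfolding entrywise_orthogonal_def
proof
  fix i
  have "Re (cnj ((c *s a) $ i) * (c *s b + (\<i> * of_real t) *s (c *s a)) $ i)
      = ((Re c)\<^sup>2 + (Im c)\<^sup>2) * Re (cnj (a $ i) * b $ i)"
    by (simp add: algebra_simps power2_eq_square)
  with assms show "Re (cnj ((c *s a) $ i) * (c *s b + (\<i> * of_real t) *s (c *s a)) $ i) = 0"
    by (simp add: entrywise_orthogonal_def)
qed

lemma entrywise_orthogonal_scaleR:
  "entrywise_orthogonal a b \<Longrightarrow> entrywise_orthogonal (r *\<^sub>R a) (s *\<^sub>R b)"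
  by (simp add: entrywise_orthogonal_def)

lemma subspace_range_matrix_vector_mult: "subspace (range ((*v) (A::'a::real_algebra_1^'n^'m)))"
proof -
  have "0 = A *v 0" "A *v x + A *v y = A *v (x + y)" "c *\<^sub>R (A *v x) = A *v (c *\<^sub>R x)" for x y c
    by (simp_all add: matrix_vector_right_distrib matrix_vector_scaleR_commute)
  then show ?thesis unfolding subspace_def by blast
qed

lemma entrywise_orthogonal_sum_diff:
  assumes "\<forall>i. cmod (v $ i) = cmod (w $ i)"
  shows "entrywise_orthogonal (v + w) (v - w)"
  unfolding entrywise_orthogonal_def
proof
  fix i
  have "(Re (v$i))\<^sup>2 + (Im (v$i))\<^sup>2 = (Re (w$i))\<^sup>2 + (Im (w$i))\<^sup>2"
    using assms by (metis cmod_power2)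
  then show "Re (cnj ((v + w) $ i) * (v - w) $ i) = 0"
    by (simp add: algebra_simps power2_eq_square)
qed

lemma Cayley_transform_unimodular:
  fixes t :: real
  shows "cmod ((1 + \<i> * t) / (1 - \<i> * t)) = 1"
proof -
  have "cmod (1 + \<i> * t) = cmod (1 - \<i> * t)" by (simp add: cmod_def)
  moreover have "1 - \<i> * t \<noteq> 0" by (simp add: complex_eq_iff)
  ultimately show ?thesis by (simp add: norm_divide)
qed

lemma orthogonally_rigid_phase_retrieval:
  assumes "orthogonally_rigid W" "subspace W" "v \<in> W" "w \<in> W"
    and "\<forall>i. cmod (v $ i) = cmod (w $ i)"
  shows "\<exists>c. cmod c = 1 \<and> v = c *s w"
proof -
  have "v + w \<in> W" "v - w \<in> W" using assms(2-4) by (simp_all add: subspace_add subspace_diff)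
  with assms(1) entrywise_orthogonal_sum_diff[OF assms(5)]
  consider "v + w = 0" | t :: real where "v - w = (\<i> * t) *s (v + w)"
    unfolding orthogonally_rigid_def by blast
  then show ?thesis
  proof cases
    case 1
    then have "v = (-1) *s w" by (simp add: vec_eq_iff add_eq_0_iff)
    then show ?thesis by (intro exI[of _ "-1"]) simp
  next
    case 2
    have "(1 - \<i> * t) * v $ i = (1 + \<i> * t) * w $ i" for i
      using 2 by (simp add: vec_eq_iff algebra_simps)
    moreover have "1 - \<i> * t \<noteq> 0" by (simp add: complex_eq_iff)
    ultimately have "v = ((1 + \<i> * t) / (1 - \<i> * t)) *s w"
      by (simp add: vec_eq_iff field_simps)
    then show ?thesis using Cayley_transform_unimodular by blast
  qed
qed

lemma degenerate_if_not_inj: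
  assumes "\<not> inj ((*v) A)"
  shows "degenerate A"
proof -
  obtain u v where "A *v u = A *v v" "u \<noteq> v"
    using assms unfolding inj_def by blast
  then obtain x where "A *v x = 0" "x \<noteq> 0"
    by (metis eq_iff_diff_eq_0 matrix_vector_mult_diff_distrib)
  then show ?thesis unfolding degenerate_def entrywise_orthogonal_def
    using inner_i_scaled_self[of "x /\<^sub>R norm x"]
    by (intro exI[of _ "x /\<^sub>R norm x"]) (simp add: matrix_vector_scaleR_commute)
qed

lemma not_orthogonally_rigid_if_degenerate:
  assumes "inj ((*v) A)" "degenerate A"
  shows "\<not> orthogonally_rigid (range ((*v) A))"
proof
  assume rigid: "orthogonally_rigid (range ((*v) A))"
  obtain x y where unit: "norm x = 1" "norm y = 1" and perp: "inner (\<i> *s x) y = 0"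
    and orth: "entrywise_orthogonal (A *v x) (A *v y)"
    using assms(2) unfolding degenerate_def by blast
  consider "A *v x = 0" | t :: real where "A *v y = (\<i> * t) *s (A *v x)"
    using rigid orth unfolding orthogonally_rigid_def by blast
  then show False
  proof cases
    case 1
    then have "x = 0" using assms(1) by (metis injD matrix_vector_mult_0_right)
    then show False using unit by simp
  next
    case 2
    then have "A *v y = A *v (t *\<^sub>R (\<i> *s x))"
      by (simp add: i_real_smult vector_scalar_commute matrix_vector_scaleR_commute)
    then have y: "y = t *\<^sub>R (\<i> *s x)" by (rule injD[OF assms(1)])
    then have "inner (\<i> *s x) y = t" using unit by (simp add: dot_square_norm)
    then have "y = 0" using perp y by simp
    then show False using unit by simp
  qed
qed

lemma orthogonally_rigid_if_not_degenerate:
  assumes "\<not> degenerate A"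
  shows "orthogonally_rigid (range ((*v) A))"
  unfolding orthogonally_rigid_def
proof (intro ballI impI)
  fix a b assume "a \<in> range ((*v) A)" "b \<in> range ((*v) A)" and orth: "entrywise_orthogonal a b"
  then obtain x y where ab: "a = A *v x" "b = A *v y" by auto
  show "a = 0 \<or> (\<exists>t::real. b = (\<i> * t) *s a)"
  proof (rule ccontr)
    assume "\<not> ?thesis"
    then have "x \<noteq> 0" and not_i_multiple: "\<And>t::real. A *v y \<noteq> (\<i> * t) *s (A *v x)"
      using ab by auto
    define t where "t = inner (\<i> *s x) y / inner x x"
    define y' where "y' = y - t *\<^sub>R (\<i> *s x)"
    have perp: "inner (\<i> *s x) y' = 0"
      using \<open>x \<noteq> 0\<close> by (simp add: y'_def t_def inner_diff_right dot_square_norm)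
    have "A *v y' = A *v y + (\<i> * of_real (- t)) *s (A *v x)"
      by (simp add: y'_def i_real_smult matrix_vector_mult_diff_distrib
          matrix_vector_scaleR_commute vector_scalar_commute)
    then have orth': "entrywise_orthogonal (A *v x) (A *v y')"
      using entrywise_orthogonal_shear[OF orth, of 1 "- t"] ab by simp
    have "y' \<noteq> 0"
    proof
      assume "y' = 0"
      then have "A *v y = (\<i> * t) *s (A *v x)"
        by (simp add: y'_def i_real_smult matrix_vector_scaleR_commute vector_scalar_commute)
      then show False using not_i_multiple by blast
    qed
    then have "norm (x /\<^sub>R norm x) = 1 \<and> norm (y' /\<^sub>R norm y') = 1
        \<and> inner (\<i> *s (x /\<^sub>R norm x)) (y' /\<^sub>R norm y') = 0
        \<and> entrywise_orthogonal (A *v (x /\<^sub>R norm x)) (A *v (y' /\<^sub>R norm y'))"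
      using \<open>x \<noteq> 0\<close> perp orth'
      by (simp add: matrix_vector_scaleR_commute vector_smult_scaleR_commute
          entrywise_orthogonal_scaleR)
    then show False using assms unfolding degenerate_def by blast
  qed
qed

lemma not_degenerate_iff:
  "\<not> degenerate A \<longleftrightarrow> A \<in> frames \<and> orthogonally_rigid (range ((*v) A))"
  using degenerate_if_not_inj not_orthogonally_rigid_if_degenerate
    orthogonally_rigid_if_not_degenerate
  unfolding frames_def by blast

lemma continuous_on_matrix_vector_mult [continuous_intros]:
  fixes A :: "'a::topological_space \<Rightarrow> 'b::real_normed_algebra_1^'n^'m"
  assumes "continuous_on S A" "continuous_on S x"
  shows "continuous_on S (\<lambda>s. A s *v x s)"
  unfolding matrix_vector_mult_def by (intro continuous_intros assms)

lemma closed_degenerate: "closed {A::complex^'n^'m. degenerate A}"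
proof -
  define S :: "((complex^'n) \<times> (complex^'n)) set"
    where "S = (sphere 0 1 \<times> sphere 0 1) \<inter> {p. inner (\<i> *s fst p) (snd p) = 0}"
  define T :: "(((complex^'n) \<times> (complex^'n)) \<times> (complex^'n^'m)) set"
    where "T = {z. entrywise_orthogonal (snd z *v fst (fst z)) (snd z *v snd (fst z))}"
  have "{A. degenerate A} = {A. \<exists>p. p \<in> S \<and> (p, A) \<in> T}"
    by (auto simp: degenerate_def S_def T_def)
  moreover have "compact S"
    unfolding S_def vector_scalar_mult_def
    by (intro compact_Int_closed compact_Times compact_sphere closed_Collect_eq continuous_intros)
  moreover have "closed T"
    unfolding T_def entrywise_orthogonal_def
    by (intro closed_Collect_all closed_Collect_eq continuous_intros)
  ultimately show ?thesis by (simp only: closed_compact_projection)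
qed

lemma differentiable_vec_nth [derivative_intros]:
  "f differentiable F \<Longrightarrow> (\<lambda>x. f x $ i) differentiable F"
  unfolding differentiable_def using bounded_linear.has_derivative[OF bounded_linear_vec_nth] by blast

lemma differentiable_vec_lambda [derivative_intros]:
  fixes f :: "'a::real_normed_vector \<Rightarrow> 'i::finite \<Rightarrow> 'b::euclidean_space"
  assumes "\<And>i. (\<lambda>x. f x i) differentiable F"
  shows "(\<lambda>x. \<chi> i. f x i) differentiable F"
proof -
  have "(\<lambda>x. axis i (f x i)) differentiable F" for i
  proof -
    have "bounded_linear (axis i :: 'b \<Rightarrow> 'b^'i)"
      by (simp add: linear_conv_bounded_linear[symmetric] linearI axis_def vec_eq_iff)
    moreover obtain D where "((\<lambda>x. f x i) has_derivative D) F"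
      using assms[of i] unfolding differentiable_def by blast
    ultimately show ?thesis
      unfolding differentiable_def by (blast dest: bounded_linear.has_derivative)
  qed
  then have "(\<lambda>x. \<Sum>i\<in>UNIV. axis i (f x i)) differentiable F"
    by (simp add: differentiable_sum)
  moreover have "(\<chi> i. f x i) = (\<Sum>i\<in>UNIV. axis i (f x i))" for x
    by (simp add: vec_eq_iff axis_def)
  ultimately show ?thesis by simp
qed

lemma differentiable_Re [derivative_intros]:
  "f differentiable F \<Longrightarrow> (\<lambda>x. Re (f x)) differentiable F"
  unfolding differentiable_def using has_derivative_Re by blast

lemma differentiable_Im [derivative_intros]:
  "f differentiable F \<Longrightarrow> (\<lambda>x. Im (f x)) differentiable F"
  unfolding differentiable_def using has_derivative_Im by blast

lemma differentiable_of_real [derivative_intros]: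
  "f differentiable F \<Longrightarrow> (\<lambda>x. of_real (f x) :: 'a::real_normed_algebra_1) differentiable F"
  unfolding differentiable_def using has_derivative_of_real by blast

lemma differentiable_cis [derivative_intros]:
  "f differentiable (at x within S) \<Longrightarrow> (\<lambda>x. cis (f x)) differentiable (at x within S)"
  unfolding differentiable_def using has_derivative_cis by blast

lemma differentiable_if_const [derivative_intros]:
  "f differentiable F \<Longrightarrow> g differentiable F \<Longrightarrow> (\<lambda>x. if b then f x else g x) differentiable F"
  by (cases b) simp_all

definition replace_column :: "'n \<Rightarrow> 'a^'m \<Rightarrow> 'a^'n^'m \<Rightarrow> 'a^'n^'m" where
  "replace_column l c B = (\<chi> i l'. if l' = l then c $ i else B $ i $ l')"

lemma column_replace_column:
  "column l' (replace_column l c B) = (if l' = l then c else column l' B)"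
  by (simp add: vec_eq_iff column_def replace_column_def)

lemma matrix_vector_mult_replace_column:
  fixes B :: "'a::comm_ring_1^'n^'m"
  shows "replace_column l c B *v u = B *v u + u $ l *s (c - column l B)"
proof -
  have "(\<Sum>l'\<in>UNIV. (if l' = l then c $ i else B $ i $ l') * u $ l')
      = (\<Sum>l'\<in>UNIV. B $ i $ l' * u $ l') + u $ l * (c $ i - B $ i $ l)" for i
    by (simp add: if_distrib[of "\<lambda>a. a * _"] sum.If_cases algebra_simps
        sum.remove[of UNIV l] Compl_eq_Diff_UNIV[symmetric])
  then show ?thesis
    by (simp add: vec_eq_iff matrix_vector_mult_def replace_column_def column_def algebra_simps)
qed

lemma matrix_eq_if_mult_eq:
  fixes A C :: "'a::field^'n^'m"
  assumes cols: "\<And>l. l \<noteq> j \<Longrightarrow> l \<noteq> k \<Longrightarrow> column l A = column l C"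
    and "x $ j \<noteq> 0" "z $ j = 0" "z $ k \<noteq> 0"
    and "A *v x = C *v x" "A *v z = C *v z"
  shows "A = C"
proof -
  define D where "D = A - C"
  have "j \<noteq> k" using assms(3,4) by auto
  have D0: "D $ i $ l = 0" if "l \<noteq> j" "l \<noteq> k" for i l
    using cols[OF that] by (simp add: D_def vec_eq_iff column_def)
  have Dmult: "(D *v u) $ i = D $ i $ j * u $ j + D $ i $ k * u $ k" for u i
  proof -
    have "(D *v u) $ i = (\<Sum>l\<in>{j, k}. D $ i $ l * u $ l)"
      unfolding matrix_vector_mult_def vec_lambda_beta
      by (rule sum.mono_neutral_right) (auto simp: D0)
    then show ?thesis using \<open>j \<noteq> k\<close> by simp
  qed
  have "D *v z = 0" "D *v x = 0"
    using assms(5,6) by (simp_all add: D_def matrix_vector_mult_diff_rdistrib)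
  then have "D $ i $ k = 0" "D $ i $ j = 0" for i
    using Dmult[of z i] Dmult[of x i] assms(2-4) by (simp_all add: vec_eq_iff)
  then have "D = 0"
    using D0 by (metis vec_eq_iff zero_index)
  then show ?thesis by (simp add: D_def)
qed

text \<open>The chart recovering a degenerate matrix \<open>A\<close> with \<open>A x \<bottom> A (z + \<rho> x)\<close> entrywise,
  \<open>x\<^sub>j = 1\<close>, \<open>z\<^sub>j = 0\<close>, \<open>z\<^sub>k \<noteq> 0\<close>. Row \<open>i\<close> of column \<open>j\<close> of the parameter matrix \<open>P\<close> holds the polar data
  \<open>r\<^sub>i + \<theta>\<^sub>i \<i>\<close> of \<open>(A x)\<^sub>i = r\<^sub>i cis \<theta>\<^sub>i\<close>, and the real parts of column \<open>k\<close> hold the \<open>s\<^sub>i\<close> with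
  \<open>(A (z + \<rho> x))\<^sub>i = \<i> s\<^sub>i cis \<theta>\<^sub>i\<close>. The \<open>4N - 3\<close> real coordinates of \<open>x\<close>, \<open>z\<close> and \<open>\<rho>\<close> are stored in
  the imaginary parts of column \<open>k\<close>, at the rows \<open>g ` chart_slots j\<close>; another row \<open>i0\<close> is left
  at zero, so the chart is defined on a hyperplane. The remaining columns of \<open>P\<close> are those of \<open>A\<close>,
  and columns \<open>k\<close>, \<open>j\<close> of \<open>A\<close> are solved from \<open>A z = A (z + \<rho> x) - \<rho> A x\<close> and \<open>A x\<close>.\<close>

definition chart_slots :: "'n \<Rightarrow> (nat \<times> 'n) set" where
  "chart_slots j = {0, 1, 2, 3} \<times> - {j} \<union> {(4, j)}"

definition chart_x :: "(nat \<times> 'n \<Rightarrow> 'm) \<Rightarrow> 'n \<Rightarrow> 'n \<Rightarrow> complex^'n^'m \<Rightarrow> complex^'n" where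
  "chart_x g j k P =
     (\<chi> l. if l = j then 1 else Complex (Im (P $ g (0, l) $ k)) (Im (P $ g (1, l) $ k)))"

definition chart_z :: "(nat \<times> 'n \<Rightarrow> 'm) \<Rightarrow> 'n \<Rightarrow> 'n \<Rightarrow> complex^'n^'m \<Rightarrow> complex^'n" where
  "chart_z g j k P =
     (\<chi> l. if l = j then 0 else Complex (Im (P $ g (2, l) $ k)) (Im (P $ g (3, l) $ k)))"

definition chart_rho :: "(nat \<times> 'n \<Rightarrow> 'm) \<Rightarrow> 'n \<Rightarrow> 'n \<Rightarrow> complex^'n^'m \<Rightarrow> real" where
  "chart_rho g j k P = Im (P $ g (4, j) $ k)"

definition chart_v :: "'n \<Rightarrow> complex^'n^'m \<Rightarrow> complex^'m" where
  "chart_v j P = (\<chi> i. of_real (Re (P $ i $ j)) * cis (Im (P $ i $ j)))"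

definition chart_w :: "'n \<Rightarrow> 'n \<Rightarrow> complex^'n^'m \<Rightarrow> complex^'m" where
  "chart_w j k P = (\<chi> i. \<i> * of_real (Re (P $ i $ k)) * cis (Im (P $ i $ j)))"

definition chart :: "(nat \<times> 'n \<Rightarrow> 'm) \<Rightarrow> 'n \<Rightarrow> 'n \<Rightarrow> complex^'n^'m \<Rightarrow> complex^'n^'m" where
  "chart g j k P =
     (let x = chart_x g j k P; z = chart_z g j k P; v = chart_v j P;
          b = chart_w j k P - chart_rho g j k P *\<^sub>R v;
          C = replace_column k (column k P + (1 / z $ k) *s (b - P *v z)) P
      in replace_column j (column j C + (v - C *v x)) C)"

definition chart_domain :: "(nat \<times> 'n \<Rightarrow> 'm) \<Rightarrow> 'n \<Rightarrow> 'n \<Rightarrow> 'm \<Rightarrow> (complex^'n^'m) set" where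
  "chart_domain g j k i0 = {P. Im (P $ i0 $ k) = 0 \<and> chart_z g j k P $ k \<noteq> 0}"

lemma chart_mult:
  assumes "chart_z g j k P $ k \<noteq> 0"
  shows "chart g j k P *v chart_x g j k P = chart_v j P"
    and "chart g j k P *v chart_z g j k P = chart_w j k P - chart_rho g j k P *\<^sub>R chart_v j P"
  using assms
  by (simp_all add: chart_def Let_def matrix_vector_mult_replace_column chart_x_def chart_z_def)

lemma column_chart:
  "l \<noteq> j \<Longrightarrow> l \<noteq> k \<Longrightarrow> column l (chart g j k P) = column l P"
  by (simp add: chart_def Let_def column_replace_column)

lemma negligible_chart_domain:
  fixes g :: "nat \<times> 'n::finite \<Rightarrow> 'm::finite"
  shows "negligible (chart_domain g j k i0)"
proof -
  define a :: "complex^'n^'m" where "a = axis i0 (axis k \<i>)"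
  have "a \<noteq> 0" by (simp add: a_def)
  moreover have "chart_domain g j k i0 \<subseteq> {P. a \<bullet> P = 0}"
    by (auto simp: chart_domain_def a_def inner_axis' inner_complex_def)
  ultimately show ?thesis using negligible_hyperplane negligible_subset by blast
qed

lemma differentiable_on_chart: "chart g j k differentiable_on chart_domain g j k i0"
  unfolding differentiable_on_def
proof
  fix P0 assume "P0 \<in> chart_domain g j k i0"
  then have "chart_z g j k P0 $ k \<noteq> 0" by (simp add: chart_domain_def)
  have parts: "chart_x g j k differentiable (at P0 within chart_domain g j k i0)"
    "chart_z g j k differentiable (at P0 within chart_domain g j k i0)"
    "chart_rho g j k differentiable (at P0 within chart_domain g j k i0)"
    "chart_v j differentiable (at P0 within chart_domain g j k i0)"
    "chart_w j k differentiable (at P0 within chart_domain g j k i0)"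
    unfolding chart_x_def chart_z_def chart_rho_def chart_v_def chart_w_def Complex_eq
    by (intro derivative_intros)+
  show "chart g j k differentiable (at P0 within chart_domain g j k i0)"
    unfolding chart_def Let_def replace_column_def column_def matrix_vector_mult_def
      vector_scalar_mult_def
    using \<open>chart_z g j k P0 $ k \<noteq> 0\<close> by (auto intro!: derivative_intros parts)
qed

lemma negligible_chart_image: "negligible (chart g j k ` chart_domain g j k i0)"
  by (rule negligible_differentiable_image_negligible[OF order_refl negligible_chart_domain
        differentiable_on_chart])

lemma orthogonal_polar_form:
  assumes "Re (cnj p * q) = 0"
  obtains r \<theta> s where "p = of_real r * cis \<theta>" "q = \<i> * of_real s * cis \<theta>"
proof -
  have rotate: "u = (u * cis (- \<theta>)) * cis \<theta>" for u \<theta>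
    by (simp add: cis_mult flip: mult.assoc)
  have imaginary: "Re u = 0 \<Longrightarrow> u = \<i> * of_real (Im u)" for u
    by (simp add: complex_eq_iff)
  show ?thesis
  proof (cases "p = 0")
    case True
    have "\<i> * cis (Arg q - pi / 2) = cis (Arg q)"
      by (simp add: complex_eq_iff cos_diff sin_diff)
    then have "q = \<i> * of_real (cmod q) * cis (Arg q - pi / 2)"
      by (metis rcis_cmod_Arg rcis_def mult.commute mult.left_commute)
    with True show ?thesis using that[of 0 "Arg q - pi / 2" "cmod q"] by simp
  next
    case False
    define \<theta> where "\<theta> = Arg p"
    have p: "p = of_real (cmod p) * cis \<theta>"
      unfolding \<theta>_def by (simp add: rcis_cmod_Arg[of p, unfolded rcis_def])
    then have "cnj p * q = of_real (cmod p) * (q * cis (- \<theta>))"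
      by (metis cis_cnj complex_cnj_complex_of_real complex_cnj_mult mult.assoc mult.commute)
    then have "cmod p * Re (q * cis (- \<theta>)) = 0"
      using assms by (simp only:) simp
    then have "Re (q * cis (- \<theta>)) = 0" using False by simp
    then have "q = \<i> * of_real (Im (q * cis (- \<theta>))) * cis \<theta>"
      using rotate[of q \<theta>] imaginary by metis
    with p show ?thesis using that by blast
  qed
qed

lemma entrywise_orthogonal_scaleR_self:
  assumes "entrywise_orthogonal a (r *\<^sub>R a)" "r \<noteq> 0"
  shows "a = 0"
proof -
  have "r * ((Re (a $ i))\<^sup>2 + (Im (a $ i))\<^sup>2) = 0" for i
    using assms(1) by (simp add: entrywise_orthogonal_def power2_eq_square algebra_simps)
  then have "a $ i = 0" for i
    using assms(2) by (simp add: sum_power2_eq_zero_iff complex_eq_iff)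
  then show ?thesis by (simp add: vec_eq_iff)
qed

lemma degenerate_collinear_in_kernel:
  assumes "norm x = 1" "inner (\<i> *s x) y = 0" "entrywise_orthogonal (A *v x) (A *v y)"
    and "y = \<mu> *s x" "y \<noteq> 0"
  shows "A *v x = 0"
proof -
  have y: "y = Re \<mu> *\<^sub>R x + Im \<mu> *\<^sub>R (\<i> *s x)"
    using assms(4) by (simp add: vec_eq_iff complex_eq_iff)
  then have "inner (\<i> *s x) y = Im \<mu>"
    using assms(1) by (simp add: inner_add_right inner_i_scaled_self dot_square_norm)
  then have "y = Re \<mu> *\<^sub>R x" using assms(2) y by simp
  with assms(3,5) show ?thesis
    by (metis entrywise_orthogonal_scaleR_self matrix_vector_scaleR_commute scaleR_zero_left)
qed

lemma matrix_eq_0_if_kernel_unique_index: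
  assumes "A *v x = 0" "x $ j = 1" "\<And>k. k = j"
  shows "A = 0"
proof -
  have single: "UNIV = {j}" using assms(3) by auto
  have "A *v x = column j A"
    using assms(2) unfolding matrix_vector_mult_def column_def single by simp
  then have "A $ i $ l = 0" for i l
    using assms(1) assms(3)[of l] by (simp add: vec_eq_iff column_def)
  then show ?thesis by (simp add: vec_eq_iff)
qed

lemma degenerate_normal_form:
  assumes "degenerate A"
  shows "A = 0 \<or> (\<exists>j k x z \<rho>. x $ j = 1 \<and> z $ j = 0 \<and> z $ k \<noteq> 0
           \<and> entrywise_orthogonal (A *v x) (A *v (z + \<rho> *\<^sub>R x)))"
proof -
  obtain x y where unit: "norm x = 1" "norm y = 1" and perp: "inner (\<i> *s x) y = 0"
    and orth: "entrywise_orthogonal (A *v x) (A *v y)"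
    using assms unfolding degenerate_def by blast
  obtain j where "x $ j \<noteq> 0"
    using unit by (metis norm_zero vec_eq_iff zero_index zero_neq_one)
  define c where "c = 1 / x $ j"
  define \<mu> where "\<mu> = c * y $ j"
  define x' where "x' = c *s x"
  define z where "z = c *s y - \<mu> *s x'"
  have x'j: "x' $ j = 1" and zj: "z $ j = 0"
    using \<open>x $ j \<noteq> 0\<close> by (simp_all add: x'_def z_def \<mu>_def c_def)
  have "z + Re \<mu> *\<^sub>R x' = c *s y + (\<i> * of_real (- Im \<mu>)) *s (c *s x)"
    by (simp add: z_def x'_def vec_eq_iff complex_eq_iff algebra_simps)
  then have orth': "entrywise_orthogonal (A *v x') (A *v (z + Re \<mu> *\<^sub>R x'))"
    using entrywise_orthogonal_shear[OF orth, of c "- Im \<mu>"]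
    by (simp add: x'_def vector_scalar_commute matrix_vector_mult_diff_distrib)
  show ?thesis
  proof (cases "z = 0")
    case False
    then obtain k where "z $ k \<noteq> 0" by (auto simp: vec_eq_iff)
    then show ?thesis using x'j zj orth' by blast
  next
    case True
    then have "y = \<mu> *s x"
      using \<open>x $ j \<noteq> 0\<close> by (simp add: z_def x'_def c_def vec_eq_iff field_simps)
    moreover have "y \<noteq> 0" using unit(2) by auto
    ultimately have "A *v x = 0"
      by (rule degenerate_collinear_in_kernel[OF unit(1) perp orth])
    then have "A *v x' = 0" by (simp add: x'_def vector_scalar_commute)
    show ?thesis
    proof (cases "\<exists>k. k \<noteq> j")
      case True
      then obtain k where "k \<noteq> j" by blast
      then have "axis k 1 $ j = 0" "axis k (1::complex) $ k \<noteq> 0" by (simp_all add: axis_def)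
      moreover have "entrywise_orthogonal (A *v x') (A *v (axis k 1 + 0 *\<^sub>R x'))"
        using \<open>A *v x' = 0\<close> by (simp add: entrywise_orthogonal_def)
      ultimately show ?thesis using x'j by blast
    next
      case False
      then have "A = 0" using matrix_eq_0_if_kernel_unique_index[OF \<open>A *v x' = 0\<close> x'j] by blast
      then show ?thesis ..
    qed
  qed
qed

lemma matrix_in_chart_image:
  fixes g :: "nat \<times> 'n::finite \<Rightarrow> 'm::finite" and A :: "complex^'n^'m"
  assumes "inj_on g (chart_slots j)" "g ` chart_slots j \<subseteq> - {i0}"
    and "x $ j = 1" "z $ j = 0" "z $ k \<noteq> 0"
    and orth: "entrywise_orthogonal (A *v x) (A *v (z + \<rho> *\<^sub>R x))"
  shows "A \<in> chart g j k ` chart_domain g j k i0"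
proof -
  have "j \<noteq> k" using assms(4,5) by auto
  have "\<forall>i. \<exists>r \<theta> s. (A *v x) $ i = of_real r * cis \<theta>
      \<and> (A *v (z + \<rho> *\<^sub>R x)) $ i = \<i> * of_real s * cis \<theta>"
    using orth orthogonal_polar_form unfolding entrywise_orthogonal_def by metis
  then obtain r \<theta> s where polar: "\<And>i. (A *v x) $ i = of_real (r i) * cis (\<theta> i)"
    "\<And>i. (A *v (z + \<rho> *\<^sub>R x)) $ i = \<i> * of_real (s i) * cis (\<theta> i)"
    by metis
  define param :: "nat \<times> 'n \<Rightarrow> real" where
    "param = (\<lambda>(b, l). if b = 0 then Re (x $ l) else if b = 1 then Im (x $ l)
       else if b = 2 then Re (z $ l) else if b = 3 then Im (z $ l) else \<rho>)"
  define P where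
    "P = (\<chi> i l. if l = j then Complex (r i) (\<theta> i)
       else if l = k then Complex (s i)
         (if i \<in> g ` chart_slots j then param (the_inv_into (chart_slots j) g i) else 0)
       else A $ i $ l)"
  have slot: "Im (P $ g p $ k) = param p" if "p \<in> chart_slots j" for p
    using that \<open>j \<noteq> k\<close> by (simp add: P_def the_inv_into_f_f[OF assms(1)])
  have "chart_x g j k P = x" "chart_z g j k P = z" "chart_rho g j k P = \<rho>"
    using assms(3,4)
    by (auto simp: vec_eq_iff chart_x_def chart_z_def chart_rho_def slot chart_slots_def
        param_def complex_eq_iff)
  moreover have "chart_v j P = A *v x" "chart_w j k P = A *v (z + \<rho> *\<^sub>R x)"
    using \<open>j \<noteq> k\<close> by (simp_all add: vec_eq_iff chart_v_def chart_w_def P_def polar)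
  moreover have "Im (P $ i0 $ k) = 0"
    using assms(2) \<open>j \<noteq> k\<close> by (auto simp: P_def)
  ultimately have "P \<in> chart_domain g j k i0"
    and "chart g j k P *v x = A *v x" and "chart g j k P *v z = A *v z"
    using chart_mult[of g j k P] assms(5)
    by (simp_all add: chart_domain_def matrix_vector_right_distrib matrix_vector_scaleR_commute)
  moreover have "column l A = column l (chart g j k P)" if "l \<noteq> j" "l \<noteq> k" for l
    using that by (simp add: column_chart) (simp add: vec_eq_iff column_def P_def)
  ultimately show ?thesis
    using matrix_eq_if_mult_eq[of j k A "chart g j k P" x z] assms(3-5) by auto
qed

lemma card_chart_slots: "card (chart_slots (j::'n)) = 4 * (CARD('n::finite) - 1) + 1"
proof -
  have "card (chart_slots j) = 4 * card (- {j}) + 1"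
    by (simp add: chart_slots_def card_cartesian_product)
  then show ?thesis by (simp add: Compl_eq_Diff_UNIV card_Diff_subset)
qed

lemma chart_slots_embedding:
  fixes j :: "'n::finite" and i0 :: "'m::finite"
  assumes "CARD('m) \<ge> 4 * CARD('n) - 2"
  shows "\<exists>g :: nat \<times> 'n \<Rightarrow> 'm. inj_on g (chart_slots j) \<and> g ` chart_slots j \<subseteq> - {i0}"
proof -
  have "card (- {i0}) = CARD('m) - 1"
    by (simp add: Compl_eq_Diff_UNIV card_Diff_subset)
  moreover have "CARD('n) > 0" by simp
  ultimately have "card (chart_slots j) \<le> card (- {i0})"
    using assms unfolding card_chart_slots by linarith
  moreover have "finite (chart_slots j)" by (simp add: chart_slots_def)
  ultimately show ?thesis
    using card_le_inj[of "chart_slots j" "- {i0}"] by auto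
qed

lemma negligible_degenerate:
  assumes "CARD('m::finite) \<ge> 4 * CARD('n::finite) - 2"
  shows "negligible {A :: complex^'n^'m. degenerate A}"
proof -
  fix i0 :: 'm
  obtain g :: "'n \<Rightarrow> nat \<times> 'n \<Rightarrow> 'm"
    where g: "\<And>j. inj_on (g j) (chart_slots j)" "\<And>j. g j ` chart_slots j \<subseteq> - {i0}"
    using chart_slots_embedding[OF assms, of _ i0] by metis
  have "negligible ({0} \<union> (\<Union>(j, k). chart (g j) j k ` chart_domain (g j) j k i0))"
    by (intro negligible_Un negligible_sing negligible_Union) (auto intro: negligible_chart_image)
  moreover have
    "{A. degenerate A} \<subseteq> {0} \<union> (\<Union>(j, k). chart (g j) j k ` chart_domain (g j) j k i0)"
  proof
    fix A :: "complex^'n^'m" assume "A \<in> {A. degenerate A}"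
    then consider "A = 0" | j k x z \<rho> where "x $ j = 1" "z $ j = 0" "z $ k \<noteq> 0"
        "entrywise_orthogonal (A *v x) (A *v (z + \<rho> *\<^sub>R x))"
      using degenerate_normal_form by blast
    then show "A \<in> {0} \<union> (\<Union>(j, k). chart (g j) j k ` chart_domain (g j) j k i0)"
    proof cases
      case (2 j k)
      then have "A \<in> chart (g j) j k ` chart_domain (g j) j k i0"
        using matrix_in_chart_image[OF g] by blast
      then show ?thesis by blast
    qed simp
  qed
  ultimately show ?thesis by (rule negligible_subset)
qed

lemma istopology_pushforward: "istopology (\<lambda>U. U \<subseteq> T \<and> openin X {x \<in> topspace X. f x \<in> U})"
  unfolding istopology_def
proof (rule conjI; intro allI impI)
  fix S S'
  assume "S \<subseteq> T \<and> openin X {x \<in> topspace X. f x \<in> S}"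
    and "S' \<subseteq> T \<and> openin X {x \<in> topspace X. f x \<in> S'}"
  moreover have "{x \<in> topspace X. f x \<in> S \<inter> S'}
      = {x \<in> topspace X. f x \<in> S} \<inter> {x \<in> topspace X. f x \<in> S'}" by auto
  ultimately show "S \<inter> S' \<subseteq> T \<and> openin X {x \<in> topspace X. f x \<in> S \<inter> S'}"
    by auto
next
  fix K
  assume "\<forall>S\<in>K. S \<subseteq> T \<and> openin X {x \<in> topspace X. f x \<in> S}"
  moreover have "{x \<in> topspace X. f x \<in> \<Union>K} = (\<Union>S\<in>K. {x \<in> topspace X. f x \<in> S})" by auto
  ultimately show "\<Union>K \<subseteq> T \<and> openin X {x \<in> topspace X. f x \<in> \<Union>K}"
    by (auto intro!: openin_Union)
qed

lemma openin_gr_top: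
  "openin (gr_top (t::'n::finite itself)) U \<longleftrightarrow> U \<subseteq> grassmannian t \<and>
     openin (top_of_set (frames :: (complex^'n^'m::finite) set)) {A \<in> frames. range ((*v) A) \<in> U}"
proof -
  have "istopology (\<lambda>U. U \<subseteq> grassmannian t \<and>
      openin (top_of_set (frames :: (complex^'n^'m) set)) {A \<in> frames. range ((*v) A) \<in> U})"
    using istopology_pushforward[of "grassmannian t" "top_of_set frames" "\<lambda>A. range ((*v) A)"]
    by simp
  then show ?thesis by (simp add: gr_top_def)
qed

lemma topspace_gr_top:
  "topspace (gr_top (t::'n::finite itself)) = (grassmannian t :: (complex^'m::finite) set set)"
proof -
  have "{A \<in> (frames :: (complex^'n^'m) set). range ((*v) A) \<in> grassmannian t} = frames"
    by (auto simp: grassmannian_def)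
  then have "openin (gr_top t) (grassmannian t :: (complex^'m) set set)"
    by (simp add: openin_gr_top)
  moreover have "U \<subseteq> grassmannian t" if "openin (gr_top t) (U :: (complex^'m) set set)" for U
    using that by (simp add: openin_gr_top)
  ultimately show ?thesis
    unfolding topspace_def by blast
qed

lemma gr_top_closure_of_eq_grassmannian:
  fixes N :: "(complex^'n::finite^'m::finite) set"
  assumes "negligible N" and "U \<subseteq> grassmannian TYPE('n)"
    and "\<And>A. A \<notin> N \<Longrightarrow> A \<in> frames \<and> range ((*v) A) \<in> U"
  shows "gr_top TYPE('n) closure_of U = grassmannian TYPE('n)"
proof
  show "gr_top TYPE('n) closure_of U \<subseteq> grassmannian TYPE('n)"
    using closure_of_subset_topspace[of "gr_top TYPE('n)" U] by (simp add: topspace_gr_top)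
next
  show "grassmannian TYPE('n) \<subseteq> gr_top TYPE('n) closure_of U"
  proof
    fix W assume W: "W \<in> (grassmannian TYPE('n) :: (complex^'m) set set)"
    then obtain A0 :: "complex^'n^'m" where "A0 \<in> frames" "W = range ((*v) A0)"
      by (auto simp: grassmannian_def)
    show "W \<in> gr_top TYPE('n) closure_of U"
      unfolding in_closure_of topspace_gr_top
    proof (intro conjI W allI impI)
      fix T assume T: "W \<in> T \<and> openin (gr_top TYPE('n)) T"
      then obtain V where "open V"
        and V: "{A \<in> (frames :: (complex^'n^'m) set). range ((*v) A) \<in> T} = frames \<inter> V"
        unfolding openin_gr_top openin_open by blast
      then have "A0 \<in> V" using \<open>A0 \<in> frames\<close> \<open>W = range ((*v) A0)\<close> T by blast
      then have "\<not> V \<subseteq> N"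
        using open_not_negligible[OF \<open>open V\<close>] negligible_subset[OF assms(1)] by blast
      then obtain A where "A \<in> V" "A \<notin> N" by blast
      then have "range ((*v) A) \<in> T" "range ((*v) A) \<in> U" using V assms(3) by blast+
      then show "\<exists>W'. W' \<in> U \<and> W' \<in> T" by blast
    qed
  qed
qed

theorem theorem3p1:
  assumes "CARD('m::finite) \<ge> 4 * CARD('n::finite) - 2"
  shows "\<exists>U. openin (gr_top TYPE('n)) U
           \<and> (gr_top TYPE('n)) closure_of U = grassmannian TYPE('n)
           \<and> (\<forall>W\<in>U. \<forall>v\<in>W. \<forall>w\<in>W.
                 (\<forall>i. cmod ((v::complex^'m) $ i) = cmod (w $ i))
                 \<longrightarrow> (\<exists>c::complex. cmod c = 1 \<and> v = c *s w))"
proof (intro exI conjI)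
  define U where "U = {W \<in> grassmannian TYPE('n). orthogonally_rigid (W :: (complex^'m) set)}"
  have preimage: "{A \<in> frames. range ((*v) A) \<in> U} = - {A :: complex^'n^'m. degenerate A}"
    using not_degenerate_iff by (auto simp: U_def grassmannian_def)
  show "openin (gr_top TYPE('n)) U"
    unfolding openin_gr_top preimage openin_open
    using closed_degenerate not_degenerate_iff
    by (auto simp: U_def intro!: exI[of _ "- {A. degenerate A}"])
  show "gr_top TYPE('n) closure_of U = grassmannian TYPE('n)"
    using negligible_degenerate[OF assms] not_degenerate_iff
    by (intro gr_top_closure_of_eq_grassmannian) (auto simp: U_def grassmannian_def)
  show "\<forall>W\<in>U. \<forall>v\<in>W. \<forall>w\<in>W.
      (\<forall>i. cmod (v $ i) = cmod (w $ i)) \<longrightarrow> (\<exists>c. cmod c = 1 \<and> v = c *s w)"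
    by (auto simp: U_def grassmannian_def
        intro: orthogonally_rigid_phase_retrieval[OF _ subspace_range_matrix_vector_mult])
qed

end
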